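(* $R(B_{3,3},S_3)=6$.
   Context: For graphs $G_1,G_2$, $R(G_1,G_2)$ is the least integer $N$ such that every red/blue edge-coloring of $K_N$ contains a red copy of $G_1$ or a blue copy of $G_2$. $S_3$ denotes the star with $3$ edges ($4$ vertices). $B_{3,3}$ denotes the bistar on $6$ vertices: two adjacent vertices each of degree $3$, and $4$ further vertices of degree $1$. *)

theory Defs
  imports Main "HOL-Library.Ramsey"
begin

type_synonym 'a ugraph = "'a set \<times> 'a set set"

definition simple_graph :: "'a ugraph \<Rightarrow> bool" where
  "simple_graph G \<longleftrightarrow> finite (fst G) \<and> snd G \<subseteq> [fst G]\<^bsup>2\<^esup>"

definition degree :: "'a ugraph \<Rightarrow> 'a \<Rightarrow> nat" where
  "degree G v = card {e \<in> snd G. v \<in> e}"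

text \<open>A copy is a subgraph isomorphic to the given graph; it need not be induced.\<close>

definition contains_copy :: "'b ugraph \<Rightarrow> 'a ugraph \<Rightarrow> bool" where
  "contains_copy G H \<longleftrightarrow>
     (\<exists>\<phi>. inj_on \<phi> (fst H) \<and> \<phi> ` fst H \<subseteq> fst G \<and> (\<forall>e\<in>snd H. \<phi> ` e \<in> snd G))"

datatype colour = Red | Blue

text \<open>The vertices of the complete graph on \<open>N\<close> vertices are the numbers below \<open>N\<close>.
  A colouring is a total function on sets, of which only the values on the edges matter.\<close>

definition colour_graph :: "nat \<Rightarrow> (nat set \<Rightarrow> colour) \<Rightarrow> colour \<Rightarrow> nat ugraph" where
  "colour_graph N c k = ({..<N}, {e \<in> [{..<N}]\<^bsup>2\<^esup>. c e = k})"

definition ramsey_number :: "'a ugraph \<Rightarrow> 'b ugraph \<Rightarrow> nat" where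
  "ramsey_number G1 G2 =
     (LEAST N. \<forall>c. contains_copy (colour_graph N c Red) G1 \<or>
                   contains_copy (colour_graph N c Blue) G2)"

definition star3 :: "nat ugraph" where
  "star3 = ({0, 1, 2, 3}, {{0, 1}, {0, 2}, {0, 3}})"

definition bistar33 :: "nat ugraph" where
  "bistar33 = ({0, 1, 2, 3, 4, 5}, {{0, 1}, {0, 2}, {0, 3}, {1, 4}, {1, 5}})"

lemma simple_graph_star3: "simple_graph star3"
  by (simp add: simple_graph_def star3_def nsets_def)

lemma simple_graph_bistar33: "simple_graph bistar33"
  by (simp add: simple_graph_def bistar33_def nsets_def)

lemma degree_bistar33:
  "degree bistar33 0 = 3" "degree bistar33 1 = 3"
  "v \<in> {2, 3, 4, 5} \<Longrightarrow> degree bistar33 v = 1"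
proof -
  have "{e \<in> snd bistar33. 0 \<in> e} = {{0, 1}, {0, 2}, {0, 3}}"
    by (auto simp: bistar33_def)
  then show "degree bistar33 0 = 3"
    by (simp add: degree_def doubleton_eq_iff)
  have "{e \<in> snd bistar33. 1 \<in> e} = {{0, 1}, {1, 4}, {1, 5}}"
    by (auto simp: bistar33_def)
  then show "degree bistar33 1 = 3"
    by (simp add: degree_def doubleton_eq_iff)
  have "{e \<in> snd bistar33. v \<in> e} = {{if v < 4 then 0 else 1, v}}" if "v \<in> {2, 3, 4, 5}"
    using that by (auto simp: bistar33_def)
  then show "v \<in> {2, 3, 4, 5} \<Longrightarrow> degree bistar33 v = 1"
    by (simp add: degree_def)
qed

end

theory Submission imports Defs begin

text \<open>
  Suppose that the blue degrees in a colouring of \<open>K\<^sub>6\<close> are at most 2. If some red edge \<open>uv\<close> has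
  no common blue neighbour, the other four vertices split into two red neighbours of \<open>u\<close> and two
  red neighbours of \<open>v\<close>, which is a red bistar. Otherwise fix \<open>u\<close> and send each red neighbour \<open>v\<close>
  of \<open>u\<close> to a common blue neighbour \<open>w\<close> of \<open>u\<close> and \<open>v\<close>. As \<open>w\<close> has no blue neighbours besides
  \<open>u\<close> and \<open>v\<close>, this map is injective, so \<open>u\<close> has at most 2 red and at most 2 blue neighbours,
  although its degree is 5. On fewer than 6 vertices, the all-red colouring shows the lower bound.
\<close>

text \<open>In a simple graph \<open>{v, v}\<close> is no edge, having only one element, so no
  vertex is its own neighbour.\<close>

definition neighbours :: "'a ugraph \<Rightarrow> 'a \<Rightarrow> 'a set" where
  "neighbours G v = {w. {v, w} \<in> snd G}"

lemma contains_copy_star3: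
  assumes "simple_graph G" and "card (neighbours G v) \<ge> 3"
  shows "contains_copy G star3"
proof -
  obtain A where "A \<subseteq> neighbours G v" "card A = 3"
    using assms(2) by (meson obtain_subset_with_card_n)
  then obtain x y z where d: "x \<noteq> y" "y \<noteq> z" "x \<noteq> z"
    and e: "{v, x} \<in> snd G" "{v, y} \<in> snd G" "{v, z} \<in> snd G"
    by (auto simp: card_3_iff neighbours_def)
  have "\<And>w. {v, w} \<in> snd G \<Longrightarrow> v \<noteq> w \<and> v \<in> fst G \<and> w \<in> fst G"
    using assms(1) by (auto simp: simple_graph_def nsets_def)
  with d e show ?thesis
    unfolding contains_copy_def star3_def
    \<comment> \<open>The list serves as the embedding: its entry at position \<open>i\<close> is
      the image of vertex \<open>i\<close>, with \<open>0\<close> the centre.\<close>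
    by (intro exI[of _ "(!) [v, x, y, z]"]) (auto simp: numeral_eq_Suc)
qed

lemma contains_copy_bistar33:
  assumes "simple_graph G" and "distinct [u, v, a, b, d, e]"
    and "v \<in> neighbours G u" and "{a, b} \<subseteq> neighbours G u" and "{d, e} \<subseteq> neighbours G v"
  shows "contains_copy G bistar33"
proof -
  have "\<And>x y. {x, y} \<in> snd G \<Longrightarrow> x \<in> fst G \<and> y \<in> fst G"
    using assms(1) by (auto simp: simple_graph_def nsets_def)
  with assms(2-) show ?thesis
    unfolding contains_copy_def bistar33_def neighbours_def
    by (intro exI[of _ "(!) [u, v, a, b, d, e]"]) (auto simp: numeral_eq_Suc)
qed

lemma contains_copy_card_le:
  assumes "contains_copy G H" and "finite (fst G)"
  shows "card (fst H) \<le> card (fst G)"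
  using assms by (metis contains_copy_def card_inj_on_le)

lemma simple_graph_colour_graph: "simple_graph (colour_graph N c k)"
  by (auto simp: simple_graph_def colour_graph_def)

lemma neighbours_colour_graph:
  "neighbours (colour_graph N c k) v = {w. v < N \<and> w < N \<and> v \<noteq> w \<and> c {v, w} = k}"
  by (auto simp: neighbours_def colour_graph_def nsets_def card_2_iff doubleton_eq_iff)

lemma K6_contains_copy:
  "contains_copy (colour_graph 6 c Red) bistar33 \<or> contains_copy (colour_graph 6 c Blue) star3"
proof (rule disjCI)
  assume no_star: "\<not> contains_copy (colour_graph 6 c Blue) star3"
  define R where "R = neighbours (colour_graph 6 c Red)"
  define B where "B = neighbours (colour_graph 6 c Blue)"
  have R_iff: "w \<in> R v \<longleftrightarrow> v < 6 \<and> w < 6 \<and> v \<noteq> w \<and> c {v, w} = Red" for v w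
    by (simp add: R_def neighbours_colour_graph)
  have B_iff: "w \<in> B v \<longleftrightarrow> v < 6 \<and> w < 6 \<and> v \<noteq> w \<and> c {v, w} = Blue" for v w
    by (simp add: B_def neighbours_colour_graph)
  have B_sym: "w \<in> B v \<longleftrightarrow> v \<in> B w" for v w
    by (auto simp: B_iff insert_commute)
  have fin: "finite (R v)" "finite (B v)" for v
    by (auto intro: finite_subset[of _ "{..<6}"] simp: R_iff B_iff)
  have B_le: "card (B v) \<le> 2" for v
    using contains_copy_star3[OF simple_graph_colour_graph, of 6 c Blue v] no_star
    by (fastforce simp: B_def)
  have not_Blue: "c e \<noteq> Blue \<longleftrightarrow> c e = Red" for e
    by (cases "c e") auto
  have compl: "R 0 \<union> B 0 = {..<6} - {0}" "R 0 \<inter> B 0 = {}"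
    by (auto simp: R_iff B_iff not_Blue)
  have "card (R 0) + card (B 0) = 5"
    using card_Un_disjoint[OF fin compl(2)] compl(1) by simp
  then have card_less: "card (B 0) < card (R 0)"
    using B_le[of 0] by linarith
  have "\<exists>v\<in>R 0. B 0 \<inter> B v = {}"
  proof (rule ccontr)
    assume "\<not> ?thesis"
    then have "\<forall>v\<in>R 0. \<exists>w. w \<in> B 0 \<inter> B v"
      by (auto simp: ex_in_conv)
    then obtain f where f: "\<And>v. v \<in> R 0 \<Longrightarrow> f v \<in> B 0 \<inter> B v"
      by (auto dest!: bchoice)
    have "inj_on f (R 0)"
    proof (rule inj_onI, rule ccontr)
      fix v w assume vw: "v \<in> R 0" "w \<in> R 0" "f v = f w" "v \<noteq> w"
      \<comment> \<open>Blue adjacency is symmetric, so the shared value of \<open>f\<close> would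
        have three blue neighbours.\<close>
      have "{0, v, w} \<subseteq> B (f v)"
        using f[OF vw(1)] f[OF vw(2)] vw(3) B_sym by auto
      moreover have "card {0, v, w} = 3"
        using vw by (auto simp: R_iff)
      ultimately show False
        using card_mono[OF fin(2), of "{0, v, w}" "f v"] B_le[of "f v"] by linarith
    qed
    then have "card (R 0) \<le> card (B 0)"
      using f by (intro card_inj_on_le[of f]) (auto simp: fin)
    with card_less show False by simp
  qed
  then obtain v where v: "v \<in> R 0" "B 0 \<inter> B v = {}" by blast
  \<comment> \<open>The four vertices left to serve as leaves: two will hang from \<open>0\<close>
    and two from \<open>v\<close>.\<close>
  define W where "W = {..<6} - {0, v}"
  have W: "finite W" "card W = 4"
    using v(1) by (auto simp: W_def R_iff card_Diff_subset)
  have c0: "c {0, v} = Red" using v(1) by (simp add: R_iff)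
  have sub: "B 0 \<subseteq> W" "B v \<subseteq> W"
    using c0 by (auto simp: W_def B_iff insert_commute)
  have "card (W - B 0) \<ge> 2"
    using B_le[of 0] by (simp add: card_Diff_subset[OF fin(2) sub(1)] W)
  \<comment> \<open>\<open>A\<close> becomes the leaves at \<open>0\<close>, so it must avoid
    \<open>B 0\<close>; the rest of \<open>W\<close> becomes the leaves at \<open>v\<close>, so
    \<open>A\<close> must absorb \<open>B v\<close>. Disjointness of \<open>B 0\<close> and
    \<open>B v\<close> puts \<open>B v\<close> inside \<open>W - B 0\<close>, and the two
    cardinality bounds leave room for size 2.\<close>
  then obtain A where A: "B v \<subseteq> A" "A \<subseteq> W - B 0" "card A = 2"
    using exists_subset_between[of "B v" 2 "W - B 0"] B_le[of v] sub v(2) W(1) by blast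
  have "A \<subseteq> W" "finite A"
    using A W(1) by (auto intro: finite_subset)
  then have "card (W - A) = 2"
    by (simp add: card_Diff_subset W A(3))
  with A(3) obtain a b d e where ab: "A = {a, b}" "a \<noteq> b" and de: "W - A = {d, e}" "d \<noteq> e"
    by (auto simp: card_2_iff)
  have mem: "a \<in> W - B 0" "b \<in> W - B 0" "d \<in> W - A" "e \<in> W - A"
    using ab(1) de(1) A(2) by blast+
  show "contains_copy (colour_graph 6 c Red) bistar33"
  proof (rule contains_copy_bistar33[OF simple_graph_colour_graph], fold R_def)
    show "distinct [0, v, a, b, d, e]"
      using mem ab de(2) v(1) by (simp add: W_def R_iff) blast
    show "v \<in> R 0" by (rule v(1))
    show "{a, b} \<subseteq> R 0"
      using mem by (auto simp: W_def R_iff B_iff not_Blue)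
    have "d \<notin> B v" "e \<notin> B v"
      using mem A(1) by blast+
    then show "{d, e} \<subseteq> R v"
      using mem v(1) by (simp add: W_def R_iff B_iff not_Blue)
  qed
qed

theorem theorem5: "ramsey_number bistar33 star3 = 6"
  unfolding ramsey_number_def
proof (rule Least_equality)
  show "\<forall>c. contains_copy (colour_graph 6 c Red) bistar33 \<or>
            contains_copy (colour_graph 6 c Blue) star3"
    using K6_contains_copy by blast
next
  fix N
  assume "\<forall>c. contains_copy (colour_graph N c Red) bistar33 \<or>
              contains_copy (colour_graph N c Blue) star3"
  \<comment> \<open>The image of any edge of \<open>star3\<close> would have to be blue, but this
    colouring has no blue edge.\<close>
  moreover have "\<not> contains_copy (colour_graph N (\<lambda>_. Red) Blue) star3"
    by (auto simp: contains_copy_def colour_graph_def star3_def)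
  ultimately have "contains_copy (colour_graph N (\<lambda>_. Red) Red) bistar33"
    by blast
  from contains_copy_card_le[OF this] show "6 \<le> N"
    by (simp add: colour_graph_def bistar33_def)
qed

end
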